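(* Let $\mathcal S=\{1,\ldots,K\}$ be the set of satellites and let $\Delta>0$. For each $i\in\mathcal S$ let $E_i^{\min}<E_i^{\max}$, $\theta_i\in(0,1)$, $\delta_{H,i}\ge 0$, and for each slot $t=0,1,2,\ldots$ let $H_i(t)\ge 0$ be the realized harvestable power, $\hat H_i(t)$ its causal estimate, and $P_i^{\mathrm{load}}(t)$ the implemented load. Suppose the battery energies evolve by $$E_i(t+1)=\min\{E_i^{\max},\;E_i(t)+\Delta(\theta_iH_i(t)-P_i^{\mathrm{load}}(t))\}.$$ Suppose that for every $i\in\mathcal S$: (1) $E_i(0)\in[E_i^{\min},E_i^{\max}]$; (2) $|\hat H_i(t)-H_i(t)|\le\delta_{H,i}$ for all $t$; (3) every implemented action satisfies, for all $t$, $$\Delta P_i^{\mathrm{load}}(t)\le E_i(t)-E_i^{\min}+\Delta\theta_i[\hat H_i(t)-\delta_{H,i}]^+ .$$ Then $E_i(t)\in[E_i^{\min},E_i^{\max}]$ for all $t$ and all $i\in\mathcal S$, for every harvest realization satisfying the error bound in (2).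
   Context: Notation: $[x]^+=\max\{x,0\}$. Here $E_i(t)$ is the stored battery energy of satellite $i$ at the start of slot $t$, $\theta_i$ is the charging efficiency, and $\Delta$ is the slot duration. The load is $P_i^{\mathrm{load}}(t)=P_i^{\mathrm{bus}}(t)+P_i^{\mathrm{fix}}+e_i(t)$, the sum of the non-communication bus load, the fixed communication/circuit load and the RF communication load. Information structure: at the start of slot $t$ the controller knows $E_i(t)$, the current channel gains, the estimate $\hat H_i(t)$ and the bound $\delta_{H,i}$. Its action (hence $P_i^{\mathrm{load}}(t)$) uses only $\hat H_i(t)$, whereas the battery update uses the realized $H_i(t)$. *)

theory Defs
  imports Complex_Main
begin

definition pos_part :: "real \<Rightarrow> real" where
  "pos_part x = max x 0"

definition battery_update :: "real \<Rightarrow> real \<Rightarrow> real \<Rightarrow> real \<Rightarrow> real \<Rightarrow> real \<Rightarrow> real" where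
  "battery_update \<Delta> Emax \<theta> e h p = min Emax (e + \<Delta> * (\<theta> * h - p))"

text \<open>The load constraint mentions the estimate \<open>hhat\<close> and the bound \<open>\<delta>\<close>, and deliberately
  not the realized harvest, which is unknown when the action is chosen.\<close>

definition robust_load :: "real \<Rightarrow> real \<Rightarrow> real \<Rightarrow> real \<Rightarrow> real \<Rightarrow> real \<Rightarrow> real \<Rightarrow> bool" where
  "robust_load \<Delta> Emin \<theta> \<delta> e hhat p \<longleftrightarrow>
     \<Delta> * p \<le> e - Emin + \<Delta> * \<theta> * pos_part (hhat - \<delta>)"

end

theory Submission
  imports Defs
begin

text \<open>The error bound makes \<open>pos_part (hhat - \<delta>)\<close> a lower bound on the realized harvest, so a
  robust load cannot drain the battery below its minimum, while the cap in the update enforces the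
  maximum. This one-step bound does not use the range of the current energy, so no induction over
  the slots is needed.\<close>

text \<open>Both arguments of the maximum lie below \<open>h\<close>: \<open>hhat - \<delta>\<close>
  by the error bound, and \<open>0\<close> because the harvest is nonnegative.\<close>

lemma pos_part_le_of_estimate:
  assumes "0 \<le> h" and "\<bar>hhat - h\<bar> \<le> \<delta>"
  shows "pos_part (hhat - \<delta>) \<le> h"
  using assms unfolding pos_part_def by linarith

lemma battery_update_in_range:
  assumes "0 \<le> \<Delta>" and "0 \<le> \<theta>" and "Emin \<le> Emax"
    and "0 \<le> h" and "\<bar>hhat - h\<bar> \<le> \<delta>"
    and load: "robust_load \<Delta> Emin \<theta> \<delta> e hhat p"
  shows "battery_update \<Delta> Emax \<theta> e h p \<in> {Emin..Emax}"
proof -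
  have "\<Delta> * \<theta> * pos_part (hhat - \<delta>) \<le> \<Delta> * \<theta> * h"
    using assms by (intro mult_left_mono pos_part_le_of_estimate) auto
  \<comment> \<open>The energy \<open>e\<close> cancels: the load draws at most
    \<open>e - Emin\<close> plus harvest that is certain to arrive, so at least \<open>Emin\<close>
    remains before capping.\<close>
  with load have "Emin \<le> e + \<Delta> * (\<theta> * h - p)"
    unfolding robust_load_def by (simp add: algebra_simps)
  \<comment> \<open>Capping cannot push the value below \<open>Emin\<close>, since the cap
    \<open>Emax\<close> itself lies above it.\<close>
  with \<open>Emin \<le> Emax\<close> show ?thesis
    by (simp add: battery_update_def)
qed

theorem proposition1:
  fixes K :: nat
    and \<Delta> :: real
    and Emin Emax \<theta> \<delta> :: "nat \<Rightarrow> real"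
    and H Hhat Pload E :: "nat \<Rightarrow> nat \<Rightarrow> real"
  assumes "\<Delta> > 0"
    and "\<And>i. i \<in> {1..K} \<Longrightarrow> Emin i < Emax i"
    and "\<And>i. i \<in> {1..K} \<Longrightarrow> 0 < \<theta> i \<and> \<theta> i < 1"
    and "\<And>i. i \<in> {1..K} \<Longrightarrow> \<delta> i \<ge> 0"
    and "\<And>i t. i \<in> {1..K} \<Longrightarrow> H i t \<ge> 0"
    and "\<And>i t. i \<in> {1..K} \<Longrightarrow>
           E i (Suc t) = battery_update \<Delta> (Emax i) (\<theta> i) (E i t) (H i t) (Pload i t)"
    and "\<And>i. i \<in> {1..K} \<Longrightarrow> E i 0 \<in> {Emin i..Emax i}"
    and "\<And>i t. i \<in> {1..K} \<Longrightarrow> \<bar>Hhat i t - H i t\<bar> \<le> \<delta> i"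
    and "\<And>i t. i \<in> {1..K} \<Longrightarrow>
           robust_load \<Delta> (Emin i) (\<theta> i) (\<delta> i) (E i t) (Hhat i t) (Pload i t)"
  shows "\<forall>i\<in>{1..K}. \<forall>t. E i t \<in> {Emin i..Emax i}"
proof (intro ballI allI)
  fix i t
  assume i: "i \<in> {1..K}"
  show "E i t \<in> {Emin i..Emax i}"
  \<comment> \<open>Slot 0 is the initial condition; any later energy is the output of an update
    from the preceding slot \<open>s\<close>.\<close>
  proof (cases t)
    case 0
    then show ?thesis using assms(7)[OF i] by simp
  next
    case (Suc s)
    have "battery_update \<Delta> (Emax i) (\<theta> i) (E i s) (H i s) (Pload i s) \<in> {Emin i..Emax i}"
      using assms(1) assms(2,3)[OF i] assms(5,8,9)[OF i, of s]
      by (intro battery_update_in_range) auto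
    then show ?thesis
      unfolding Suc assms(6)[OF i] .
  qed
qed

end
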